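(* Let $K$ be a field, let $G$ be a group with neutral element $\varepsilon$, let $A=\bigoplus_{g\in G}A_g$ be a finite-dimensional $G$-graded $K$-algebra with a homogeneous basis $(e_i)_{i\in J}$, where $J=\bigcup_{g\in G}J_g$ (disjoint union) and $(e_i)_{i\in J_g}$ is a basis of $A_g$ for each $g\in G$, and let $(c_{ij\ell})_{i,j,\ell\in J}$ be the associated structure constants, so that $e_ie_j=\sum_{\ell\in J}c_{ij\ell}e_\ell$ for all $i,j\in J$. Let $\sigma\in G$ and let $\alpha=(\alpha_\ell)_{\ell\in J_\sigma}$ be a family of scalars in $K$. Let $P(\sigma,\alpha)$ be the $\sigma$-paratrophic matrix associated with $A$ and $\alpha$, and for each $g\in G$ let $C_g$ be the matrix with rows indexed by $J_{\sigma g^{-1}}\times J_\sigma$ and columns indexed by $J_g$, whose entry on row $(r,\ell)$ and column $j$ is $c_{rj\ell}$. The following are equivalent: (1) $P(\sigma,\alpha)$ is invertible. (2) $|J_\varepsilon|=|J_\sigma|$, the submatrix $P(\sigma,\alpha)_{J_\varepsilon,J_\sigma}$ is invertible, and $\operatorname{rank} C_g=|J_g|$ for any $g\in G$. (3) For any $g\in G$ we have $|J_{\sigma g^{-1}}|=|J_g|$ and the submatrix $P(\sigma,\alpha)_{J_{\sigma g^{-1}},J_g}$ is invertible.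
   Context: Algebras are associative and unital over the field $K$. A $G$-grading on $A$ is a decomposition $A=\bigoplus_{g\in G}A_g$ into subspaces with $A_gA_h\subseteq A_{gh}$ for all $g,h\in G$. If $A_g=0$, then $J_g=\emptyset$. The $\sigma$-paratrophic matrix $P(\sigma,\alpha)\in M_J(K)$ is the matrix with rows and columns indexed by $J$ whose $(i,j)$-entry is $\sum_{\ell\in J_\sigma}\alpha_\ell c_{ij\ell}$ for $i,j\in J$. A sum indexed by the empty set is $0$. For $F,F'\subseteq J$, $P(\sigma,\alpha)_{F,F'}$ denotes the submatrix of $P(\sigma,\alpha)$ obtained by intersecting rows in $F$ with columns in $F'$. When $|F|=|F'|$ it is a square matrix (with rows and columns possibly indexed by different sets), and invertibility is meant in the usual sense. Convention: a matrix with an empty set of rows or an empty set of columns is an empty matrix, is invertible, and has rank $0$. *)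

theory Defs
  imports Complex_Main "HOL-Library.Disjoint_Sets" "HOL-Library.Function_Algebras"
    "HOL-Algebra.Group"
begin

(* The sort {ring, monoid_mult} is ring_1 without 0 \<noteq> 1, so the zero algebra is allowed. *)

locale unital_algebra = vector_space scale
  for scale :: "'k::field \<Rightarrow> 'a::{ring, monoid_mult} \<Rightarrow> 'a" +
  assumes scale_mult_left: "scale c x * y = scale c (x * y)"
    and scale_mult_right: "x * scale c y = scale c (x * y)"

locale finite_dimensional_algebra = unital_algebra scale
  for scale :: "'k::field \<Rightarrow> 'a::{ring, monoid_mult} \<Rightarrow> 'a" +
  assumes finitely_spanned: "\<exists>B. finite B \<and> span B = UNIV"

(* Every element is, in exactly one way, a finitely supported sum of components f g \<in> V g.
   The condition f g = 0 outside I only makes f unique as a total function. *)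

definition is_direct_sum :: "'g set \<Rightarrow> ('g \<Rightarrow> 'a::comm_monoid_add set) \<Rightarrow> bool" where
  "is_direct_sum I V \<longleftrightarrow>
     (\<forall>a. \<exists>!f. (\<forall>g\<in>I. f g \<in> V g) \<and> (\<forall>g. g \<notin> I \<longrightarrow> f g = 0) \<and>
             finite {g. f g \<noteq> 0} \<and> a = (\<Sum>g\<in>{g. f g \<noteq> 0}. f g))"

locale graded_algebra = finite_dimensional_algebra scale + grp?: group G
  for scale :: "'k::field \<Rightarrow> 'a::{ring, monoid_mult} \<Rightarrow> 'a"
    and G :: "('g, 'm) monoid_scheme" (structure) +
  fixes A :: "'g \<Rightarrow> 'a set"
  assumes subspace_component: "g \<in> carrier G \<Longrightarrow> subspace (A g)"
    and direct_sum: "is_direct_sum (carrier G) A"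
    and mult_component:
      "\<lbrakk>g \<in> carrier G; h \<in> carrier G; x \<in> A g; y \<in> A h\<rbrakk> \<Longrightarrow> x * y \<in> A (g \<otimes> h)"

locale homogeneous_basis = graded_algebra scale G A
  for scale :: "'k::field \<Rightarrow> 'a::{ring, monoid_mult} \<Rightarrow> 'a"
    and G :: "('g, 'm) monoid_scheme" (structure)
    and A :: "'g \<Rightarrow> 'a set" +
  fixes J :: "'g \<Rightarrow> 'i set"
    and e :: "'i \<Rightarrow> 'a"
  assumes disjoint_indices: "disjoint_family_on J (carrier G)"
    and inj_basis: "g \<in> carrier G \<Longrightarrow> inj_on e (J g)"
    and independent_basis: "g \<in> carrier G \<Longrightarrow> independent (e ` J g)"
    and span_basis: "g \<in> carrier G \<Longrightarrow> span (e ` J g) = A g"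

definition index_set :: "('g, 'm) monoid_scheme \<Rightarrow> ('g \<Rightarrow> 'i set) \<Rightarrow> 'i set" where
  "index_set G J = (\<Union>g\<in>carrier G. J g)"

definition structure_constants ::
    "('k \<Rightarrow> 'a::{comm_monoid_add, times} \<Rightarrow> 'a) \<Rightarrow> 'i set \<Rightarrow> ('i \<Rightarrow> 'a) \<Rightarrow> ('i \<Rightarrow> 'i \<Rightarrow> 'i \<Rightarrow> 'k) \<Rightarrow> bool"
  where
  "structure_constants scale S e c \<longleftrightarrow>
     (\<forall>i\<in>S. \<forall>j\<in>S. e i * e j = (\<Sum>l\<in>S. scale (c i j l) (e l)))"

(* A matrix is a function of a row and a column index. The finite sets R of rows and C of
   columns are passed separately, so a submatrix is the same function on smaller sets. *)

(* Empty matrices are invertible by convention, even if only one of R, C is empty. *)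

definition invertible_matrix :: "'r set \<Rightarrow> 'c set \<Rightarrow> ('r \<Rightarrow> 'c \<Rightarrow> 'k::field) \<Rightarrow> bool" where
  "invertible_matrix R C M \<longleftrightarrow> R = {} \<or> C = {} \<or>
     (\<exists>N. (\<forall>r\<in>R. \<forall>r'\<in>R. (\<Sum>j\<in>C. M r j * N j r') = (if r = r' then 1 else 0)) \<and>
          (\<forall>j\<in>C. \<forall>j'\<in>C. (\<Sum>r\<in>R. N j r * M r j') = (if j = j' then 1 else 0)))"

interpretation fun_space: vector_space "\<lambda>(c::'k::field) (v::'r \<Rightarrow> 'k) r. c * v r"
  by unfold_locales (auto simp: fun_eq_iff algebra_simps)

(* The dimension of the span of the columns, each extended by 0 outside R. *)

definition matrix_rank :: "'r set \<Rightarrow> 'c set \<Rightarrow> ('r \<Rightarrow> 'c \<Rightarrow> 'k::field) \<Rightarrow> nat" where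
  "matrix_rank R C M = fun_space.dim ((\<lambda>j r. if r \<in> R then M r j else 0) ` C)"

definition paratrophic_matrix ::
    "('g \<Rightarrow> 'i set) \<Rightarrow> ('i \<Rightarrow> 'i \<Rightarrow> 'i \<Rightarrow> 'k::field) \<Rightarrow> 'g \<Rightarrow> ('i \<Rightarrow> 'k) \<Rightarrow> 'i \<Rightarrow> 'i \<Rightarrow> 'k" where
  "paratrophic_matrix J c \<sigma> \<alpha> i j = (\<Sum>l\<in>J \<sigma>. \<alpha> l * c i j l)"

(* Used with rows J (\<sigma> g\<inverse>) \<times> J \<sigma> and columns J g, which are the only dependence on g. *)

definition slice_matrix :: "('i \<Rightarrow> 'i \<Rightarrow> 'i \<Rightarrow> 'k) \<Rightarrow> 'i \<times> 'i \<Rightarrow> 'i \<Rightarrow> 'k" where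
  "slice_matrix c = (\<lambda>(r, l) j. c r j l)"

end

theory Submission imports Defs begin

text \<open>
  Let \<open>f\<close> be the linear form on the algebra with \<open>f (e l) = \<alpha> l\<close> for \<open>l \<in> J \<sigma>\<close> and \<open>f (e l) = 0\<close> for
  the other indices. The paratrophic matrix \<open>P\<close> is the Gram matrix of the bilinear form
  \<open>f (x * y)\<close>. As \<open>f\<close> lives in degree \<open>\<sigma>\<close>, a column of degree \<open>g\<close> has nonzero entries only in rows
  of degree \<open>\<sigma> \<otimes> inv g\<close>. Since \<open>g \<mapsto> \<sigma> \<otimes> inv g\<close> permutes the group, \<open>P\<close> is, up to reordering, block
  diagonal. It is therefore invertible iff all blocks \<open>J (\<sigma> \<otimes> inv g) \<times> J g\<close> are square and
  invertible (\<open>invertible_iff_blocks\<close>).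

  The condition that the slice matrix of \<open>g\<close> has rank \<open>card (J g)\<close> says that its kernel is trivial,
  that is, that \<open>y = 0\<close> whenever \<open>y\<close> has degree \<open>g\<close> and \<open>x * y = 0\<close> for all \<open>x\<close> of degree
  \<open>\<sigma> \<otimes> inv g\<close>. If \<open>x * y = 0\<close>, then \<open>f (x * y) = 0\<close>, so this follows from the invertibility of the
  block (\<open>slice_kernel_if_block_kernel\<close>). Conversely, let \<open>f (x * y) = 0\<close> for all \<open>x\<close> of degree
  \<open>\<sigma> \<otimes> inv g\<close>. For \<open>a\<close> of degree \<open>\<one>\<close> also \<open>a * x\<close> has that degree, so that
  \<open>f (a * (x * y)) = f ((a * x) * y) = 0\<close>. The block \<open>J \<one> \<times> J \<sigma>\<close> being invertible, \<open>x * y = 0\<close>, and the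
  rank condition yields \<open>y = 0\<close> (\<open>block_kernel_if_slice_kernel\<close>). Hence \<open>P\<close>, a square matrix, has
  trivial kernel and is invertible. The argument is carried out below on structure constants.
\<close>

section \<open>Finite families and matrices with trivial kernel\<close>

lemma (in vector_space) independent_family_iff:
  assumes "finite C"
  shows "(inj_on v C \<and> independent (v ` C)) \<longleftrightarrow>
         (\<forall>x. (\<Sum>j\<in>C. scale (x j) (v j)) = 0 \<longrightarrow> (\<forall>j\<in>C. x j = 0))"
    (is "?L \<longleftrightarrow> ?R")
proof
  assume L: ?L
  show ?R
  proof (intro allI impI ballI)
    fix x j assume x: "(\<Sum>j\<in>C. scale (x j) (v j)) = 0" and j: "j \<in> C"
    have "(\<Sum>w\<in>v ` C. scale (x (the_inv_into C v w)) w) = 0"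
      using L x by (simp add: sum.reindex the_inv_into_f_f cong: sum.cong)
    then have "x (the_inv_into C v (v j)) = 0"
      using L j assms by (intro independentD[of "v ` C" "v ` C"]) auto
    then show "x j = 0" using L j by (simp add: the_inv_into_f_f)
  qed
next
  assume R: ?R
  have inj: "inj_on v C"
  proof (rule inj_onI, rule ccontr)
    fix j k assume jk: "j \<in> C" "k \<in> C" "v j = v k" "j \<noteq> k"
    define x where "x i = (if i = j then 1 else if i = k then -1 else 0 :: 'a)" for i
    have "(\<Sum>i\<in>C. scale (x i) (v i)) = (\<Sum>i\<in>{j, k}. scale (x i) (v i))"
      using assms jk by (intro sum.mono_neutral_right) (auto simp: x_def)
    also have "\<dots> = 0" using jk by (simp add: x_def)
    finally show False using R jk(1) by (force simp: x_def)
  qed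
  have "independent (v ` C)"
  proof (rule independent_if_scalars_zero)
    fix f w assume "(\<Sum>x\<in>v ` C. scale (f x) x) = 0" "w \<in> v ` C"
    then show "f w = 0" using R[rule_format, of "f \<circ> v"] inj by (auto simp: sum.reindex)
  qed (simp add: assms)
  with inj show ?L by blast
qed

text \<open>The \<open>j\<close>-th column of \<open>M\<close>, extended by \<open>0\<close> outside the row set \<open>R\<close>.\<close>

definition column :: "'r set \<Rightarrow> ('r \<Rightarrow> 'c \<Rightarrow> 'k::field) \<Rightarrow> 'c \<Rightarrow> 'r \<Rightarrow> 'k" where
  "column R M j = (\<lambda>r. if r \<in> R then M r j else 0)"

text \<open>The kernel is the one of \<open>M\<close> acting on column vectors indexed by \<open>C\<close>.\<close>

definition trivial_kernel :: "'r set \<Rightarrow> 'c set \<Rightarrow> ('r \<Rightarrow> 'c \<Rightarrow> 'k::field) \<Rightarrow> bool" where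
  "trivial_kernel R C M \<longleftrightarrow>
     (\<forall>x. (\<forall>r\<in>R. (\<Sum>j\<in>C. M r j * x j) = 0) \<longrightarrow> (\<forall>j\<in>C. x j = 0))"

lemma sum_fun_apply: "(\<Sum>j\<in>C. f j) r = (\<Sum>j\<in>C. f j r)"
  by (induction C rule: infinite_finite_induct) auto

lemma trivial_kernel_iff_columns:
  assumes "finite C"
  shows "trivial_kernel R C M \<longleftrightarrow>
         inj_on (column R M) C \<and> fun_space.independent (column R M ` C)"
proof -
  have "(\<Sum>j\<in>C. (\<lambda>r. x j * column R M j r)) = 0 \<longleftrightarrow> (\<forall>r\<in>R. (\<Sum>j\<in>C. M r j * x j) = 0)" for x
  proof -
    have "(\<Sum>j\<in>C. (\<lambda>r. x j * column R M j r)) r = (if r \<in> R then \<Sum>j\<in>C. M r j * x j else 0)" for r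
      by (simp add: sum_fun_apply column_def mult.commute)
    then show ?thesis by (auto simp: fun_eq_iff)
  qed
  then show ?thesis
    unfolding fun_space.independent_family_iff[OF assms] trivial_kernel_def by simp
qed

lemma matrix_rank_eq_card_iff:
  assumes "finite C"
  shows "matrix_rank R C M = card C \<longleftrightarrow> trivial_kernel R C M"
proof -
  have rank: "matrix_rank R C M = fun_space.dim (column R M ` C)"
    unfolding matrix_rank_def column_def ..
  show ?thesis
  proof
    assume eq: "matrix_rank R C M = card C"
    obtain B where B: "B \<subseteq> column R M ` C" "fun_space.independent B"
        "card B = fun_space.dim (column R M ` C)"
      using fun_space.basis_exists by metis
    have le: "card B \<le> card (column R M ` C)" using B(1) assms by (simp add: card_mono)
    moreover have "card (column R M ` C) \<le> card C" by (rule card_image_le[OF assms])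
    \<comment> \<open>A basis chosen among the columns has \<open>card C\<close> elements, so it uses all columns, without
      repetition.\<close>
    ultimately have card: "card (column R M ` C) = card C"
      using eq B(3) by (simp add: rank)
    then have "B = column R M ` C"
      using eq B assms by (intro card_subset_eq) (auto simp: rank)
    with card show "trivial_kernel R C M"
      using B assms by (simp add: trivial_kernel_iff_columns eq_card_imp_inj_on)
  next
    assume "trivial_kernel R C M"
    then show "matrix_rank R C M = card C"
      using assms by (simp add: rank trivial_kernel_iff_columns fun_space.dim_eq_card_independent card_image)
  qed
qed

text \<open>The standard basis vector at \<open>s\<close>.\<close>

definition unit_vector :: "'r \<Rightarrow> 'r \<Rightarrow> 'k::field" where
  "unit_vector s = (\<lambda>r. if r = s then 1 else 0)"

lemma column_in_span_unit_vectors: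
  assumes "finite R"
  shows "column R M j \<in> fun_space.span (unit_vector ` R)"
proof -
  have "column R M j = (\<Sum>s\<in>R. (\<lambda>r. M s j * unit_vector s r))"
    using assms by (auto simp: fun_eq_iff sum_fun_apply column_def unit_vector_def if_distrib cong: if_cong)
  also have "\<dots> \<in> fun_space.span (unit_vector ` R)"
    by (intro fun_space.span_sum fun_space.span_scale fun_space.span_base) auto
  finally show ?thesis .
qed

lemma trivial_kernel_card_le:
  assumes "finite R" "finite C" "trivial_kernel R C M"
  shows "card C \<le> card R"
proof -
  have "card (column R M ` C) \<le> card (unit_vector ` R :: ('a \<Rightarrow> 'c) set)"
    using assms column_in_span_unit_vectors[OF assms(1)]
    by (intro fun_space.independent_span_bound[THEN conjunct2])
       (auto simp: trivial_kernel_iff_columns)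
  also have "\<dots> \<le> card R" by (rule card_image_le[OF assms(1)])
  finally show ?thesis using assms by (simp add: trivial_kernel_iff_columns card_image)
qed

text \<open>\<open>M N = 1\<close> and \<open>N M = 1\<close>, with no exception for empty matrices: if just one of \<open>R\<close>, \<open>C\<close> is empty,
  no matrices are mutually inverse.\<close>

definition mutually_inverse ::
    "'r set \<Rightarrow> 'c set \<Rightarrow> ('r \<Rightarrow> 'c \<Rightarrow> 'k::field) \<Rightarrow> ('c \<Rightarrow> 'r \<Rightarrow> 'k) \<Rightarrow> bool" where
  "mutually_inverse R C M N \<longleftrightarrow>
     (\<forall>r\<in>R. \<forall>r'\<in>R. (\<Sum>j\<in>C. M r j * N j r') = (if r = r' then 1 else 0)) \<and>
     (\<forall>j\<in>C. \<forall>j'\<in>C. (\<Sum>r\<in>R. N j r * M r j') = (if j = j' then 1 else 0))"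

lemma mutually_inverse_sym: "mutually_inverse R C M N \<Longrightarrow> mutually_inverse C R N M"
  unfolding mutually_inverse_def by blast

lemma mutually_inverse_imp_trivial_kernel:
  assumes "finite C" "mutually_inverse R C M N"
  shows "trivial_kernel R C M"
  unfolding trivial_kernel_def
proof (intro allI impI ballI)
  fix x j assume x: "\<forall>r\<in>R. (\<Sum>j\<in>C. M r j * x j) = 0" and j: "j \<in> C"
  have "x j = (\<Sum>j'\<in>C. (if j = j' then 1 else 0) * x j')"
    using assms(1) j by (simp add: if_distrib[of "\<lambda>u. u * _"] cong: if_cong)
  also have "\<dots> = (\<Sum>j'\<in>C. (\<Sum>r\<in>R. N j r * M r j') * x j')"
    using assms(2) j by (intro sum.cong) (auto simp: mutually_inverse_def)
  also have "\<dots> = (\<Sum>r\<in>R. N j r * (\<Sum>j'\<in>C. M r j' * x j'))"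
    by (simp add: sum_distrib_left sum_distrib_right mult.assoc sum.swap[of _ C])
  also have "\<dots> = 0" using x by simp
  finally show "x j = 0" .
qed

lemma mutually_inverse_card:
  assumes "finite R" "finite C" "mutually_inverse R C M N"
  shows "card R = card C"
  using assms mutually_inverse_imp_trivial_kernel trivial_kernel_card_le mutually_inverse_sym
  by (metis le_antisym)

text \<open>For index sets of equal size, an empty matrix has both index sets empty and thus has a two-sided
  inverse, so the convention on empty matrices makes no difference.\<close>

lemma invertible_matrix_iff:
  assumes "finite R" "finite C"
  shows "card R = card C \<and> invertible_matrix R C M \<longleftrightarrow> (\<exists>N. mutually_inverse R C M N)"
proof (cases "R = {} \<or> C = {}")
  case True
  then show ?thesis
    using mutually_inverse_card[OF assms] assms
    by (auto simp: invertible_matrix_def) (auto simp: mutually_inverse_def)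
next
  case False
  then have "invertible_matrix R C M \<longleftrightarrow> (\<exists>N. mutually_inverse R C M N)"
    unfolding invertible_matrix_def mutually_inverse_def by blast
  then show ?thesis using mutually_inverse_card[OF assms] by blast
qed

lemma trivial_kernel_imp_mutually_inverse:
  assumes R: "finite R" and C: "finite C" and card: "card R = card C"
    and ker: "trivial_kernel R C M"
  shows "\<exists>N. mutually_inverse R C M N"
proof -
  have inj: "inj_on (column R M) C" and indep: "fun_space.independent (column R M ` C)"
    using ker C by (auto simp: trivial_kernel_iff_columns)
  have "\<exists>x. unit_vector s = (\<Sum>j\<in>C. (\<lambda>r. x j * column R M j r))" if s: "s \<in> R" for s
  proof -
    have "unit_vector s \<in> fun_space.span (column R M ` C)"
    proof (rule ccontr)
      \<comment> \<open>Otherwise there would be more than \<open>card R\<close> independent vectors in a space spanned by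
        \<open>card R\<close> of them.\<close>
      assume n: "unit_vector s \<notin> fun_space.span (column R M ` C)"
      have "card (insert (unit_vector s) (column R M ` C)) \<le> card (unit_vector ` R :: ('a \<Rightarrow> 'c) set)"
        using column_in_span_unit_vectors[OF R] s R n indep
        by (intro fun_space.independent_span_bound[THEN conjunct2] fun_space.independent_insertI)
           (auto intro: fun_space.span_base)
      also have "\<dots> \<le> card R" by (rule card_image_le[OF R])
      also have "\<dots> = card (column R M ` C)" using inj card by (simp add: card_image)
      finally show False
        using n C fun_space.span_base[of "unit_vector s" "column R M ` C"]
        by (auto simp: card_insert_if split: if_splits)
    qed
    then obtain u where "unit_vector s = (\<Sum>w\<in>column R M ` C. (\<lambda>r. u w * w r))"
      unfolding fun_space.span_finite[OF finite_imageI[OF C]] by blast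
    then have "unit_vector s = (\<Sum>j\<in>C. (\<lambda>r. (u \<circ> column R M) j * column R M j r))"
      using inj by (simp add: sum.reindex)
    then show ?thesis by blast
  qed
  then obtain X where X: "\<And>s. s \<in> R \<Longrightarrow> unit_vector s = (\<Sum>j\<in>C. (\<lambda>r. X s j * column R M j r))"
    by metis
  have MN: "(\<Sum>j\<in>C. M r j * X s j) = (if r = s then 1 else 0)" if "r \<in> R" "s \<in> R" for r s
    using X[OF that(2), THEN fun_cong, of r] that(1)
    by (simp add: sum_fun_apply column_def unit_vector_def mult.commute)
  \<comment> \<open>A right inverse \<open>N\<close> is also a left inverse, since \<open>M (N M - 1) = 0\<close>.\<close>
  have NM: "(\<Sum>r\<in>R. X r j * M r j') = (if j = j' then 1 else 0)" if j: "j \<in> C" "j' \<in> C" for j j'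
  proof -
    define y where "y i = (\<Sum>r\<in>R. X r i * M r j') - (if i = j' then 1 else 0)" for i
    have "(\<Sum>i\<in>C. M s i * y i) = 0" if s: "s \<in> R" for s
    proof -
      have "(\<Sum>i\<in>C. M s i * (\<Sum>r\<in>R. X r i * M r j')) = (\<Sum>r\<in>R. (\<Sum>i\<in>C. M s i * X r i) * M r j')"
        by (simp add: sum_distrib_left sum_distrib_right mult.assoc sum.swap[of _ C])
      also have "\<dots> = (\<Sum>r\<in>R. (if s = r then 1 else 0) * M r j')"
        using s by (intro sum.cong) (auto simp: MN)
      also have "\<dots> = M s j'"
        using s R by (simp add: if_distrib[of "\<lambda>u. u * _"] cong: if_cong)
      also have "\<dots> = (\<Sum>i\<in>C. M s i * (if i = j' then 1 else 0))"
        using j C by (simp add: if_distrib cong: if_cong)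
      finally show ?thesis by (simp add: y_def right_diff_distrib sum_subtractf)
    qed
    then have "y j = 0" using ker j unfolding trivial_kernel_def by blast
    then show ?thesis by (simp add: y_def)
  qed
  show ?thesis
    by (rule exI[of _ "\<lambda>j r. X r j"]) (simp add: mutually_inverse_def MN NM)
qed

section \<open>Homogeneous bases\<close>

context homogeneous_basis
begin

abbreviation "S \<equiv> index_set G J"

lemma J_subset: "g \<in> carrier G \<Longrightarrow> J g \<subseteq> S"
  by (auto simp: index_set_def)

lemma J_unique: "\<lbrakk>g \<in> carrier G; h \<in> carrier G; i \<in> J g; i \<in> J h\<rbrakk> \<Longrightarrow> g = h"
  using disjoint_indices by (auto simp: disjoint_family_on_def)

lemma independent_component:
  assumes "g \<in> carrier G" "finite F" "F \<subseteq> J g" "(\<Sum>i\<in>F. scale (x i) (e i)) = 0" "i \<in> F"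
  shows "x i = 0"
  using independent_family_iff[OF assms(2), of e] assms
    inj_on_subset[OF inj_basis[OF assms(1)] assms(3)]
    independent_mono[OF independent_basis[OF assms(1)] image_mono[OF assms(3)]]
  by blast

text \<open>Grouping a relation by degree gives a decomposition of \<open>0\<close> into homogeneous components,
  so each of them vanishes.\<close>

lemma independent_homogeneous:
  assumes F: "finite F" "F \<subseteq> S" and zero: "(\<Sum>i\<in>F. scale (x i) (e i)) = 0" and i: "i \<in> F"
  shows "x i = 0"
proof -
  define f where "f g = (if g \<in> carrier G then \<Sum>i\<in>F \<inter> J g. scale (x i) (e i) else 0)" for g
  obtain d where d: "\<And>i. i \<in> F \<Longrightarrow> d i \<in> carrier G \<and> i \<in> J (d i)"
    using F(2) unfolding index_set_def by (metis UN_E subsetD)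
  have dJ: "d j = g" if "j \<in> F" "g \<in> carrier G" "j \<in> J g" for j g
    using J_unique that d by blast
  have supp: "{g. f g \<noteq> 0} \<subseteq> d ` F"
    using dJ by (force simp: f_def split: if_splits intro: sum.neutral)
  have fin: "finite {g. f g \<noteq> 0}" using supp F(1) by (meson finite_imageI finite_subset)
  have "(\<Sum>g\<in>{g. f g \<noteq> 0}. f g) = (\<Sum>g\<in>d ` F. f g)"
    using supp F(1) by (intro sum.mono_neutral_left) auto
  also have "\<dots> = (\<Sum>g\<in>d ` F. \<Sum>i\<in>{i \<in> F. d i = g}. scale (x i) (e i))"
  proof (rule sum.cong)
    fix g assume g: "g \<in> d ` F"
    then have "F \<inter> J g = {i \<in> F. d i = g}" "g \<in> carrier G" using d dJ by blast+
    then show "f g = (\<Sum>i\<in>{i \<in> F. d i = g}. scale (x i) (e i))" by (simp add: f_def)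
  qed simp
  also have "\<dots> = 0" using zero sum.image_gen[OF F(1), of "\<lambda>i. scale (x i) (e i)" d] by simp
  finally have sum: "(\<Sum>g\<in>{g. f g \<noteq> 0}. f g) = 0" .
  have mem: "f g \<in> A g" if "g \<in> carrier G" for g
    using that unfolding f_def span_basis[OF that, symmetric]
    by (auto intro!: span_sum intro: span_scale span_base)
  define Q where "Q f \<longleftrightarrow> (\<forall>g\<in>carrier G. f g \<in> A g) \<and> (\<forall>g. g \<notin> carrier G \<longrightarrow> f g = 0) \<and>
      finite {g. f g \<noteq> 0} \<and> 0 = (\<Sum>g\<in>{g. f g \<noteq> 0}. f g)" for f
  have "\<exists>!f. Q f" using direct_sum unfolding is_direct_sum_def Q_def by blast
  \<comment> \<open>Both \<open>f\<close> and the zero family decompose \<open>0\<close>.\<close>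
  moreover have "Q f" unfolding Q_def using mem fin sum by (simp add: f_def)
  moreover have "Q (\<lambda>_. 0)" unfolding Q_def using subspace_component subspace_0 by auto
  ultimately have "f = (\<lambda>_. 0)" by blast
  then have "f (d i) = 0" by simp
  then have "(\<Sum>i\<in>F \<inter> J (d i). scale (x i) (e i)) = 0" using d i by (simp add: f_def)
  then show "x i = 0"
    using d i F(1) by (intro independent_component[of "d i" "F \<inter> J (d i)"]) auto
qed

text \<open>Each finite set of indices labels an independent family, whose size is bounded by that of a finite
  spanning set.\<close>

lemma finite_index_set: "finite S"
proof -
  have *: "inj_on e F \<and> independent (e ` F)" if "finite F" "F \<subseteq> S" for F
    using independent_homogeneous[OF that] independent_family_iff[OF that(1), of e] by blast
  have inj: "inj_on e S"
  proof (rule inj_onI)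
    fix i j assume ij: "i \<in> S" "j \<in> S" "e i = e j"
    then have "inj_on e {i, j}" using *[of "{i, j}"] by blast
    then show "i = j" using ij(3) by (rule inj_onD) auto
  qed
  obtain B where B: "finite B" "span B = UNIV" using finitely_spanned by blast
  show ?thesis
  proof (rule ccontr)
    assume "infinite S"
    then obtain F where F: "F \<subseteq> S" "finite F" "card F = Suc (card B)"
      using infinite_arbitrarily_large by blast
    then have "card (e ` F) \<le> card B"
      using *[of F] independent_span_bound[OF B(1), of "e ` F"] unfolding B(2) by blast
    moreover have "card (e ` F) = card F"
      using inj_on_subset[OF inj F(1)] by (rule card_image)
    ultimately show False using F(3) by simp
  qed
qed

lemma finite_J: "g \<in> carrier G \<Longrightarrow> finite (J g)"
  using finite_index_set J_subset finite_subset by blast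

lemma coefficients_unique:
  assumes "(\<Sum>i\<in>S. scale (x i) (e i)) = (\<Sum>i\<in>S. scale (y i) (e i))" "i \<in> S"
  shows "x i = y i"
  using independent_homogeneous[OF finite_index_set subset_refl, of "\<lambda>i. x i - y i" i] assms
  by (simp add: scale_left_diff_distrib sum_subtractf)

lemma component_expansion:
  assumes g: "g \<in> carrier G" and a: "a \<in> A g"
  obtains x where "a = (\<Sum>i\<in>S. scale (x i) (e i))" "\<And>i. i \<notin> J g \<Longrightarrow> x i = 0"
proof -
  obtain u where "a = (\<Sum>w\<in>e ` J g. scale (u w) w)"
    using a span_finite[OF finite_imageI[OF finite_J[OF g], of e]]
    unfolding span_basis[OF g, symmetric] by auto
  then have "a = (\<Sum>i\<in>J g. scale (u (e i)) (e i))"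
    using inj_basis[OF g] by (simp add: sum.reindex)
  also have "\<dots> = (\<Sum>i\<in>S. scale (if i \<in> J g then u (e i) else 0) (e i))"
    using J_subset[OF g] finite_index_set by (intro sum.mono_neutral_cong_left) auto
  finally show ?thesis by (rule that) simp
qed

end

section \<open>Structure constants\<close>

text \<open>A graded algebra with a homogeneous basis and its structure constants.\<close>

locale graded_structure_constants = homogeneous_basis scale G A J e
  for scale :: "'k::field \<Rightarrow> 'a::{ring, monoid_mult} \<Rightarrow> 'a"
    and G :: "('g, 'm) monoid_scheme" (structure)
    and A :: "'g \<Rightarrow> 'a set"
    and J :: "'g \<Rightarrow> 'i set"
    and e :: "'i \<Rightarrow> 'a" +
  fixes c :: "'i \<Rightarrow> 'i \<Rightarrow> 'i \<Rightarrow> 'k"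
  assumes structure_constants: "structure_constants scale S e c"
begin

lemma basis_mult: "\<lbrakk>i \<in> S; j \<in> S\<rbrakk> \<Longrightarrow> e i * e j = (\<Sum>l\<in>S. scale (c i j l) (e l))"
  using structure_constants by (simp add: structure_constants_def)

lemma structure_constant_eq_0:
  assumes "g \<in> carrier G" "h \<in> carrier G" "i \<in> J g" "j \<in> J h" "l \<in> S" "l \<notin> J (g \<otimes> h)"
  shows "c i j l = 0"
proof -
  have "e i \<in> A g" "e j \<in> A h"
    using assms span_basis span_base by (metis imageI)+
  then have "e i * e j \<in> A (g \<otimes> h)" using mult_component assms by blast
  then obtain x where x: "e i * e j = (\<Sum>i\<in>S. scale (x i) (e i))" "\<And>i. i \<notin> J (g \<otimes> h) \<Longrightarrow> x i = 0"
    using component_expansion assms by (metis grp.m_closed)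
  have "i \<in> S" "j \<in> S" using assms J_subset by blast+
  then have "c i j l = x l"
    using assms(5) x(1) basis_mult by (intro coefficients_unique) auto
  then show ?thesis using x assms by simp
qed

lemma structure_constants_assoc:
  assumes "a \<in> S" "r \<in> S" "j \<in> S" "m \<in> S"
  shows "(\<Sum>l\<in>S. c r j l * c a l m) = (\<Sum>i\<in>S. c a r i * c i j m)"
proof (rule coefficients_unique[OF _ assms(4)])
  have "(\<Sum>m\<in>S. scale (\<Sum>l\<in>S. c r j l * c a l m) (e m)) = e a * (e r * e j)"
    using assms
    by (simp add: basis_mult sum_distrib_left scale_mult_right scale_sum_right scale_sum_left)
       (rule sum.swap)
  also have "\<dots> = (e a * e r) * e j" by (simp add: mult.assoc)
  also have "\<dots> = (\<Sum>m\<in>S. scale (\<Sum>i\<in>S. c a r i * c i j m) (e m))"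
    using assms
    by (simp add: basis_mult sum_distrib_right scale_mult_left scale_sum_right scale_sum_left)
       (rule sum.swap)
  finally show "(\<Sum>m\<in>S. scale (\<Sum>l\<in>S. c r j l * c a l m) (e m)) =
      (\<Sum>m\<in>S. scale (\<Sum>i\<in>S. c a r i * c i j m) (e m))" .
qed

section \<open>The blocks of the paratrophic matrix\<close>

context
  fixes \<sigma> :: 'g and \<alpha> :: "'i \<Rightarrow> 'k"
  assumes \<sigma>: "\<sigma> \<in> carrier G"
begin

abbreviation "P \<equiv> paratrophic_matrix J c \<sigma> \<alpha>"

text \<open>In column \<open>j\<close> of degree \<open>g\<close> only rows of degree \<open>\<sigma> \<otimes> inv g\<close> matter, and in such a row only
  columns of degree \<open>g\<close>.\<close>

lemma paratrophic_eq_0: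
  assumes "g \<in> carrier G" "i \<in> S" "j \<in> J g" "i \<notin> J (\<sigma> \<otimes> inv g)"
  shows "P i j = 0"
proof -
  obtain h where h: "h \<in> carrier G" "i \<in> J h" using assms by (auto simp: index_set_def)
  have "h \<otimes> g \<noteq> \<sigma>" using h assms \<sigma> grp.inv_solve_right[of h \<sigma> g] by auto
  then have "c i j l = 0" if "l \<in> J \<sigma>" for l
    using structure_constant_eq_0[of h g i j l] h assms that J_unique[of "h \<otimes> g" \<sigma> l] \<sigma> J_subset[of \<sigma>]
    by auto
  then show ?thesis by (simp add: paratrophic_matrix_def)
qed

lemma opposite_degree: "g \<in> carrier G \<Longrightarrow> \<sigma> \<otimes> inv g \<in> carrier G"
  using \<sigma> by simp

lemma opposite_degree_inj:
  "\<lbrakk>g \<in> carrier G; h \<in> carrier G; \<sigma> \<otimes> inv g = \<sigma> \<otimes> inv h\<rbrakk> \<Longrightarrow> g = h"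
  using \<sigma> grp.inv_closed by (simp add: inj_onD[OF grp.inv_inj])

lemma paratrophic_eq_0_column:
  assumes "g \<in> carrier G" "i \<in> J (\<sigma> \<otimes> inv g)" "j \<in> S" "j \<notin> J g"
  shows "P i j = 0"
proof -
  obtain h where h: "h \<in> carrier G" "j \<in> J h" using assms by (auto simp: index_set_def)
  then have "h \<noteq> g" using assms by blast
  then have "i \<notin> J (\<sigma> \<otimes> inv h)"
    using J_unique opposite_degree opposite_degree_inj h(1) assms(1,2) by metis
  then show ?thesis
    using paratrophic_eq_0 h assms opposite_degree J_subset by blast
qed

lemma sum_row_block:
  assumes "g \<in> carrier G" "i \<in> J (\<sigma> \<otimes> inv g)"
  shows "(\<Sum>j\<in>S. P i j * x j) = (\<Sum>j\<in>J g. P i j * x j)"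
  using assms paratrophic_eq_0_column J_subset finite_index_set by (intro sum.mono_neutral_right) auto

lemma sum_column_block:
  assumes "g \<in> carrier G" "j \<in> J g"
  shows "(\<Sum>i\<in>S. x i * P i j) = (\<Sum>i\<in>J (\<sigma> \<otimes> inv g). x i * P i j)"
  using assms paratrophic_eq_0 J_subset opposite_degree finite_index_set
  by (intro sum.mono_neutral_right) auto

lemma block_inverse:
  assumes "mutually_inverse S S P N" "g \<in> carrier G"
  shows "mutually_inverse (J (\<sigma> \<otimes> inv g)) (J g) P N"
  unfolding mutually_inverse_def
proof (intro conjI ballI)
  fix r r' assume r: "r \<in> J (\<sigma> \<otimes> inv g)" "r' \<in> J (\<sigma> \<otimes> inv g)"
  then have "r \<in> S" "r' \<in> S" using J_subset opposite_degree assms by blast+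
  then show "(\<Sum>j\<in>J g. P r j * N j r') = (if r = r' then 1 else 0)"
    using assms(1) r unfolding sum_row_block[OF assms(2) r(1), symmetric] mutually_inverse_def by blast
next
  fix j j' assume j: "j \<in> J g" "j' \<in> J g"
  then have "j \<in> S" "j' \<in> S" using J_subset assms by blast+
  then show "(\<Sum>r\<in>J (\<sigma> \<otimes> inv g). N j r * P r j') = (if j = j' then 1 else 0)"
    using assms(1) j unfolding sum_column_block[OF assms(2) j(2), symmetric] mutually_inverse_def by blast
qed

lemma inverse_from_block_kernels:
  assumes "\<And>g. g \<in> carrier G \<Longrightarrow> trivial_kernel (J (\<sigma> \<otimes> inv g)) (J g) P"
  shows "\<exists>N. mutually_inverse S S P N"
proof -
  have "trivial_kernel S S P"
    unfolding trivial_kernel_def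
  proof (intro allI impI ballI)
    fix x j assume x: "\<forall>r\<in>S. (\<Sum>j\<in>S. P r j * x j) = 0" and "j \<in> S"
    then obtain g where g: "g \<in> carrier G" "j \<in> J g" by (auto simp: index_set_def)
    have "(\<Sum>j\<in>J g. P r j * x j) = 0" if "r \<in> J (\<sigma> \<otimes> inv g)" for r
      using x J_subset[OF opposite_degree[OF g(1)]] that
      unfolding sum_row_block[OF g(1) that, symmetric] by blast
    then show "x j = 0" using assms[OF g(1)] g(2) unfolding trivial_kernel_def by blast
  qed
  then show ?thesis
    using trivial_kernel_imp_mutually_inverse finite_index_set by blast
qed

lemma invertible_iff_blocks:
  "invertible_matrix S S P \<longleftrightarrow>
     (\<forall>g\<in>carrier G. card (J (\<sigma> \<otimes> inv g)) = card (J g) \<and>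
        invertible_matrix (J (\<sigma> \<otimes> inv g)) (J g) P)"
proof -
  have "invertible_matrix S S P \<longleftrightarrow> (\<exists>N. mutually_inverse S S P N)"
    using invertible_matrix_iff[OF finite_index_set finite_index_set] by simp
  also have "\<dots> \<longleftrightarrow> (\<forall>g\<in>carrier G. \<exists>N. mutually_inverse (J (\<sigma> \<otimes> inv g)) (J g) P N)"
    using block_inverse inverse_from_block_kernels mutually_inverse_imp_trivial_kernel finite_J
    by metis
  also have "\<dots> \<longleftrightarrow> (\<forall>g\<in>carrier G. card (J (\<sigma> \<otimes> inv g)) = card (J g) \<and>
        invertible_matrix (J (\<sigma> \<otimes> inv g)) (J g) P)"
    by (simp add: invertible_matrix_iff finite_J opposite_degree)
  finally show ?thesis .
qed

text \<open>Row \<open>r\<close> of the block is the combination of the rows \<open>(r, l)\<close> of the slice matrix with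
  coefficients \<open>\<alpha> l\<close>.\<close>

lemma slice_kernel_if_block_kernel:
  assumes "trivial_kernel (J (\<sigma> \<otimes> inv g)) (J g) P"
  shows "trivial_kernel (J (\<sigma> \<otimes> inv g) \<times> J \<sigma>) (J g) (slice_matrix c)"
  unfolding trivial_kernel_def
proof (rule allI, rule impI)
  fix x assume x: "\<forall>p\<in>J (\<sigma> \<otimes> inv g) \<times> J \<sigma>. (\<Sum>j\<in>J g. slice_matrix c p j * x j) = 0"
  have "(\<Sum>j\<in>J g. P r j * x j) = 0" if r: "r \<in> J (\<sigma> \<otimes> inv g)" for r
  proof -
    have "(\<Sum>j\<in>J g. P r j * x j) = (\<Sum>l\<in>J \<sigma>. \<alpha> l * (\<Sum>j\<in>J g. c r j l * x j))"
      by (simp add: paratrophic_matrix_def sum_distrib_left sum_distrib_right mult.assoc)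
         (rule sum.swap)
    also have "\<dots> = 0" using x r by (auto simp: slice_matrix_def)
    finally show ?thesis .
  qed
  then show "\<forall>j\<in>J g. x j = 0" using assms unfolding trivial_kernel_def by blast
qed

text \<open>Both sides are \<open>f (e a * e r * e j)\<close>, where \<open>f\<close> is the linear form given by \<open>\<alpha>\<close> in degree \<open>\<sigma>\<close>:
  on the left \<open>e r * e j\<close>, of degree \<open>\<sigma>\<close>, is expanded first, on the right \<open>e a * e r\<close>, of degree
  \<open>\<sigma> \<otimes> inv g\<close>.\<close>

lemma paratrophic_assoc:
  assumes g: "g \<in> carrier G" and a: "a \<in> J \<one>" and r: "r \<in> J (\<sigma> \<otimes> inv g)" and j: "j \<in> J g"
  shows "(\<Sum>l\<in>J \<sigma>. P a l * c r j l) = (\<Sum>i\<in>J (\<sigma> \<otimes> inv g). c a r i * P i j)"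
proof -
  have S: "a \<in> S" "r \<in> S" "j \<in> S"
    using J_subset[OF grp.one_closed] J_subset[OF opposite_degree[OF g]] J_subset[OF g] a r j
    by blast+
  have deg: "\<sigma> \<otimes> inv g \<otimes> g = \<sigma>" using g \<sigma> by (simp add: grp.m_assoc)
  have assoc: "(\<Sum>l\<in>J \<sigma>. c r j l * c a l m) = (\<Sum>i\<in>J (\<sigma> \<otimes> inv g). c a r i * c i j m)"
    if m: "m \<in> J \<sigma>" for m
  proof -
    have "(\<Sum>l\<in>J \<sigma>. c r j l * c a l m) = (\<Sum>l\<in>S. c r j l * c a l m)"
      using structure_constant_eq_0[OF opposite_degree[OF g] g r j] finite_index_set J_subset[OF \<sigma>]
      by (intro sum.mono_neutral_left) (auto simp: deg)
    also have "\<dots> = (\<Sum>i\<in>S. c a r i * c i j m)"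
      using structure_constants_assoc S m J_subset[OF \<sigma>] by blast
    also have "\<dots> = (\<Sum>i\<in>J (\<sigma> \<otimes> inv g). c a r i * c i j m)"
      using structure_constant_eq_0[OF grp.one_closed opposite_degree[OF g] a r] finite_index_set
        J_subset[OF opposite_degree[OF g]] opposite_degree[OF g]
      by (intro sum.mono_neutral_right) auto
    finally show ?thesis .
  qed
  have "(\<Sum>l\<in>J \<sigma>. P a l * c r j l) = (\<Sum>m\<in>J \<sigma>. \<alpha> m * (\<Sum>l\<in>J \<sigma>. c r j l * c a l m))"
    by (simp add: paratrophic_matrix_def sum_distrib_left sum_distrib_right ac_simps)
       (rule sum.swap)
  also have "\<dots> = (\<Sum>m\<in>J \<sigma>. \<alpha> m * (\<Sum>i\<in>J (\<sigma> \<otimes> inv g). c a r i * c i j m))"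
    by (simp add: assoc)
  also have "\<dots> = (\<Sum>i\<in>J (\<sigma> \<otimes> inv g). c a r i * P i j)"
    by (simp add: paratrophic_matrix_def sum_distrib_left sum_distrib_right ac_simps)
       (rule sum.swap)
  finally show ?thesis .
qed

lemma block_kernel_if_slice_kernel:
  assumes unit: "trivial_kernel (J \<one>) (J \<sigma>) P" and g: "g \<in> carrier G"
    and slice: "trivial_kernel (J (\<sigma> \<otimes> inv g) \<times> J \<sigma>) (J g) (slice_matrix c)"
  shows "trivial_kernel (J (\<sigma> \<otimes> inv g)) (J g) P"
  unfolding trivial_kernel_def
proof (rule allI, rule impI)
  fix x assume x: "\<forall>r\<in>J (\<sigma> \<otimes> inv g). (\<Sum>j\<in>J g. P r j * x j) = 0"
  have "(\<Sum>j\<in>J g. c r j l * x j) = 0" if r: "r \<in> J (\<sigma> \<otimes> inv g)" and l: "l \<in> J \<sigma>" for r l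
  proof -
    have "(\<Sum>l\<in>J \<sigma>. P a l * (\<Sum>j\<in>J g. c r j l * x j)) = 0" if a: "a \<in> J \<one>" for a
    proof -
      have "(\<Sum>l\<in>J \<sigma>. P a l * (\<Sum>j\<in>J g. c r j l * x j)) =
            (\<Sum>j\<in>J g. (\<Sum>l\<in>J \<sigma>. P a l * c r j l) * x j)"
        by (simp add: sum_distrib_left sum_distrib_right mult.assoc) (rule sum.swap)
      also have "\<dots> = (\<Sum>j\<in>J g. (\<Sum>i\<in>J (\<sigma> \<otimes> inv g). c a r i * P i j) * x j)"
        using paratrophic_assoc[OF g a r] by simp
      also have "\<dots> = (\<Sum>i\<in>J (\<sigma> \<otimes> inv g). c a r i * (\<Sum>j\<in>J g. P i j * x j))"
        by (simp add: sum_distrib_left sum_distrib_right mult.assoc) (rule sum.swap)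
      also have "\<dots> = 0" using x by simp
      finally show ?thesis .
    qed
    then show ?thesis
      using unit[unfolded trivial_kernel_def, rule_format, of "\<lambda>l. \<Sum>j\<in>J g. c r j l * x j"] l
      by blast
  qed
  then have "\<forall>p\<in>J (\<sigma> \<otimes> inv g) \<times> J \<sigma>. (\<Sum>j\<in>J g. slice_matrix c p j * x j) = 0"
    by (auto simp: slice_matrix_def)
  then show "\<forall>j\<in>J g. x j = 0" using slice unfolding trivial_kernel_def by blast
qed

lemma invertible_iff_unit_block_and_ranks:
  "invertible_matrix S S P \<longleftrightarrow>
     card (J \<one>) = card (J \<sigma>) \<and> invertible_matrix (J \<one>) (J \<sigma>) P \<and>
     (\<forall>g\<in>carrier G. matrix_rank (J (\<sigma> \<otimes> inv g) \<times> J \<sigma>) (J g) (slice_matrix c) = card (J g))"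
    (is "?L \<longleftrightarrow> ?R")
proof
  assume L: ?L
  have blocks: "card (J (\<sigma> \<otimes> inv g)) = card (J g)" "invertible_matrix (J (\<sigma> \<otimes> inv g)) (J g) P"
    if "g \<in> carrier G" for g
    using L that invertible_iff_blocks by blast+
  have "trivial_kernel (J (\<sigma> \<otimes> inv g)) (J g) P" if "g \<in> carrier G" for g
    using blocks that invertible_matrix_iff mutually_inverse_imp_trivial_kernel
    by (metis finite_J opposite_degree)
  then show ?R
    using blocks[OF \<sigma>] \<sigma> by (simp add: matrix_rank_eq_card_iff finite_J slice_kernel_if_block_kernel)
next
  assume R: ?R
  \<comment> \<open>This includes the case of empty \<open>J \<one>\<close>, where \<open>J \<sigma>\<close> is empty too.\<close>
  have "trivial_kernel (J \<one>) (J \<sigma>) P"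
    using R \<sigma> invertible_matrix_iff mutually_inverse_imp_trivial_kernel
    by (metis finite_J grp.one_closed)
  then have "trivial_kernel (J (\<sigma> \<otimes> inv g)) (J g) P" if "g \<in> carrier G" for g
    using R that by (intro block_kernel_if_slice_kernel) (auto simp: matrix_rank_eq_card_iff finite_J)
  then show ?L
    using inverse_from_block_kernels invertible_matrix_iff[OF finite_index_set finite_index_set] by blast
qed

end

end

theorem theoremA:
  fixes scale :: "'k::field \<Rightarrow> 'a::{ring, monoid_mult} \<Rightarrow> 'a"
    and G :: "('g, 'm) monoid_scheme" (structure)
    and A :: "'g \<Rightarrow> 'a set"
    and J :: "'g \<Rightarrow> 'i set"
    and e :: "'i \<Rightarrow> 'a"
    and c :: "'i \<Rightarrow> 'i \<Rightarrow> 'i \<Rightarrow> 'k"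
    and \<sigma> :: 'g
    and \<alpha> :: "'i \<Rightarrow> 'k"
  assumes "homogeneous_basis scale G A J e"
    and "structure_constants scale (index_set G J) e c"
    and "\<sigma> \<in> carrier G"
  shows
    "(invertible_matrix (index_set G J) (index_set G J) (paratrophic_matrix J c \<sigma> \<alpha>)
      \<longleftrightarrow>
      card (J \<one>) = card (J \<sigma>) \<and>
      invertible_matrix (J \<one>) (J \<sigma>) (paratrophic_matrix J c \<sigma> \<alpha>) \<and>
      (\<forall>g\<in>carrier G.
         matrix_rank (J (\<sigma> \<otimes> inv g) \<times> J \<sigma>) (J g) (slice_matrix c) = card (J g)))
     \<and>
     (invertible_matrix (index_set G J) (index_set G J) (paratrophic_matrix J c \<sigma> \<alpha>)
      \<longleftrightarrow>
      (\<forall>g\<in>carrier G.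
         card (J (\<sigma> \<otimes> inv g)) = card (J g) \<and>
         invertible_matrix (J (\<sigma> \<otimes> inv g)) (J g) (paratrophic_matrix J c \<sigma> \<alpha>)))"
proof -
  have "graded_structure_constants scale G A J e c"
    using assms(1,2) by (intro graded_structure_constants.intro graded_structure_constants_axioms.intro)
  note this[THEN graded_structure_constants.invertible_iff_unit_block_and_ranks, OF assms(3)]
    this[THEN graded_structure_constants.invertible_iff_blocks, OF assms(3)]
  then show ?thesis by blast
qed

end
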